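(* Let $J>0$ and let $k>2$ be an integer. Then, in the thermodynamic limit (number of sites $2N\to\infty$, i.e. for all sufficiently large $N$), the ground state of the antiferromagnetic Heisenberg XXX Hamiltonian on $2N$ qubits with periodic boundary conditions, $$H_{\mathrm{XXX}} = J\sum_{l=1}^{2N}\left(\sigma_x^{l}\sigma_x^{l+1}+\sigma_y^{l}\sigma_y^{l+1}+\sigma_z^{l}\sigma_z^{l+1}\right),\qquad \vec\sigma^{\,2N+1}=\vec\sigma^{\,1},$$ is a $k$-unextendible $2N$-partite state.
   Context: $\sigma_x^l,\sigma_y^l,\sigma_z^l$ denote the Pauli matrices acting on the $l$-th tensor factor of $(\mathbb{C}^2)^{\otimes 2N}$ (identity on the other factors). A ground state is a state supported on the eigenspace of the smallest eigenvalue of the Hamiltonian. $\mathcal{D}(\mathcal{H})$ is the set of density operators on $\mathcal{H}$. Bipartite $k$-extendibility: for an integer $k\ge 2$, a bipartite state $\rho_{AB}\in\mathcal{D}(\mathcal{H}_A\otimes\mathcal{H}_B)$ is $k$-extendible with respect to the subsystem $B$ if there is a state $\tilde\rho_{AB_1\cdots B_k}\in\mathcal{D}(\mathcal{H}_A\otimes\mathcal{H}_{B_1}\otimes\cdots\otimes\mathcal{H}_{B_k})$, with $\mathcal{H}_{B_i}\simeq\mathcal{H}_B$ for all $i$, such that for every $i\in\{1,\dots,k\}$ the marginal of $\tilde\rho$ on $AB_i$ (partial trace over all $B_j$, $j\ne i$) equals $\rho_{AB}$. Multipartite $k$-extendibility: a multipartite state is called $k$-extendible if it is $k$-extendible with respect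 to each of its subsystems (for each elementary subsystem, take $B$ to be that subsystem and $A$ to be all the remaining subsystems together). Otherwise it is called $k$-unextendible. Here the subsystems are the $2N$ individual qubits (sites). *)

theory Defs
  imports "Jordan_Normal_Form.Char_Poly" "Jordan_Normal_Form.Schur_Decomposition" Complex_Main
begin

text \<open>
  Operators on a Hilbert space of dimension \<open>d\<close> are complex \<open>d \<times> d\<close> matrices with respect to the
  computational basis. Throughout, basis vectors of a tensor product are ordered
  lexicographically, the leftmost factor being the most significant one: in
  \<open>\<complex>\<^sup>a \<otimes> \<complex>\<^sup>b \<otimes> \<complex>\<^sup>c\<close> the basis vector \<open>e\<^sub>x \<otimes> e\<^sub>y \<otimes> e\<^sub>z\<close> has index \<open>(x * b + y) * c + z\<close>.
\<close>

definition kron :: "complex mat \<Rightarrow> complex mat \<Rightarrow> complex mat" (infixr "\<otimes>\<^sub>m" 70) where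
  "A \<otimes>\<^sub>m B = mat (dim_row A * dim_row B) (dim_col A * dim_col B)
     (\<lambda>(i, j). A $$ (i div dim_row B, j div dim_col B) * B $$ (i mod dim_row B, j mod dim_col B))"

definition mat_trace :: "complex mat \<Rightarrow> complex" where
  "mat_trace A = (\<Sum>i<dim_row A. A $$ (i, i))"

text \<open>
  The order on \<^typ>\<open>complex\<close> is the partial one, so \<open>0 \<le> z\<close> says that \<open>z\<close> is real and nonnegative.
\<close>

definition density_operator :: "nat \<Rightarrow> complex mat \<Rightarrow> bool" where
  "density_operator d \<rho> \<longleftrightarrow>
     \<rho> \<in> carrier_mat d d \<and> mat_adjoint \<rho> = \<rho> \<and>
     (\<forall>v \<in> carrier_vec d. 0 \<le> (\<rho> *\<^sub>v v) \<bullet>c v) \<and> mat_trace \<rho> = 1"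


section \<open>Extendibility\<close>

text \<open>Partial trace over the middle factor of \<open>\<complex>\<^sup>a \<otimes> \<complex>\<^sup>b \<otimes> \<complex>\<^sup>c\<close>.\<close>

definition ptrace_mid :: "nat \<Rightarrow> nat \<Rightarrow> nat \<Rightarrow> complex mat \<Rightarrow> complex mat" where
  "ptrace_mid a b c M = mat (a * c) (a * c)
     (\<lambda>(i, j). \<Sum>y<b. M $$ (((i div c) * b + y) * c + i mod c, ((j div c) * b + y) * c + j mod c))"

text \<open>
  Marginal on \<open>A B\<^sub>i\<close> (\<open>i < k\<close>, counting from 0) of an operator on
  \<open>A \<otimes> B\<^sub>0 \<otimes> \<dots> \<otimes> B\<^sub>k\<^sub>-\<^sub>1\<close>: first trace out the \<open>k - 1 - i\<close> copies to the right of \<open>B\<^sub>i\<close>,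
  then the \<open>i\<close> copies between \<open>A\<close> and \<open>B\<^sub>i\<close>.
\<close>

definition marginal_AB :: "nat \<Rightarrow> nat \<Rightarrow> nat \<Rightarrow> nat \<Rightarrow> complex mat \<Rightarrow> complex mat" where
  "marginal_AB dA dB k i M =
     ptrace_mid dA (dB ^ i) dB (ptrace_mid (dA * dB ^ Suc i) (dB ^ (k - 1 - i)) 1 M)"

definition bipartite_extendible :: "nat \<Rightarrow> nat \<Rightarrow> nat \<Rightarrow> complex mat \<Rightarrow> bool" where
  "bipartite_extendible k dA dB \<rho> \<longleftrightarrow>
     density_operator (dA * dB) \<rho> \<and>
     (\<exists>\<sigma>. density_operator (dA * dB ^ k) \<sigma> \<and> (\<forall>i<k. marginal_AB dA dB k i \<sigma> = \<rho>))"

text \<open>Reordering of tensor factors, from \<open>\<complex>\<^sup>a \<otimes> \<complex>\<^sup>b \<otimes> \<complex>\<^sup>c\<close> to \<open>\<complex>\<^sup>a \<otimes> \<complex>\<^sup>c \<otimes> \<complex>\<^sup>b\<close>.\<close>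

definition mid_to_last :: "nat \<Rightarrow> nat \<Rightarrow> nat \<Rightarrow> complex mat \<Rightarrow> complex mat" where
  "mid_to_last a b c M =
     (let old = (\<lambda>i. ((i div b div c) * b + i mod b) * c + (i div b) mod c)
      in mat (a * c * b) (a * c * b) (\<lambda>(i, j). M $$ (old i, old j)))"

text \<open>
  A multipartite system is given by the list \<open>ds\<close> of its local dimensions. For each subsystem \<open>l\<close>,
  the state is regrouped as a bipartite one with \<open>B\<close> the \<open>l\<close>-th subsystem and \<open>A\<close> all the others.
\<close>

definition multipartite_extendible :: "nat \<Rightarrow> nat list \<Rightarrow> complex mat \<Rightarrow> bool" where
  "multipartite_extendible k ds \<rho> \<longleftrightarrow>
     density_operator (prod_list ds) \<rho> \<and>
     (\<forall>l<length ds.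
        let a = prod_list (take l ds); c = prod_list (drop (Suc l) ds)
        in bipartite_extendible k (a * c) (ds ! l) (mid_to_last a (ds ! l) c \<rho>))"

definition multipartite_unextendible :: "nat \<Rightarrow> nat list \<Rightarrow> complex mat \<Rightarrow> bool" where
  "multipartite_unextendible k ds \<rho> \<longleftrightarrow>
     density_operator (prod_list ds) \<rho> \<and> \<not> multipartite_extendible k ds \<rho>"


section \<open>Ground states\<close>

definition smallest_eigenvalue :: "complex mat \<Rightarrow> real \<Rightarrow> bool" where
  "smallest_eigenvalue H E \<longleftrightarrow>
     eigenvalue H (complex_of_real E) \<and> (\<forall>e. eigenvalue H e \<longrightarrow> E \<le> Re e)"

text \<open>
  The support of a density operator is its range, so being supported on the eigenspace of \<open>E\<close>
  means that every vector \<open>\<rho> v\<close> lies in that eigenspace.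
\<close>

definition ground_state :: "complex mat \<Rightarrow> complex mat \<Rightarrow> bool" where
  "ground_state H \<rho> \<longleftrightarrow>
     density_operator (dim_row H) \<rho> \<and>
     (\<exists>E. smallest_eigenvalue H E \<and>
        (\<forall>v \<in> carrier_vec (dim_row H).
           H *\<^sub>v (\<rho> *\<^sub>v v) = complex_of_real E \<cdot>\<^sub>v (\<rho> *\<^sub>v v)))"


section \<open>The Heisenberg XXX Hamiltonian\<close>

definition pauli_x :: "complex mat" where
  "pauli_x = mat_of_rows_list 2 [[0, 1], [1, 0]]"

definition pauli_y :: "complex mat" where
  "pauli_y = mat_of_rows_list 2 [[0, - \<i>], [\<i>, 0]]"

definition pauli_z :: "complex mat" where
  "pauli_z = mat_of_rows_list 2 [[1, 0], [0, - 1]]"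

text \<open>The operator \<open>P\<close> on the \<open>l\<close>-th of \<open>n\<close> qubits, \<open>l < n\<close>, and the identity on the others.\<close>

definition on_site :: "nat \<Rightarrow> nat \<Rightarrow> complex mat \<Rightarrow> complex mat" where
  "on_site n l P = 1\<^sub>m (2 ^ l) \<otimes>\<^sub>m P \<otimes>\<^sub>m 1\<^sub>m (2 ^ (n - 1 - l))"

definition heisenberg_bond :: "nat \<Rightarrow> nat \<Rightarrow> nat \<Rightarrow> complex mat" where
  "heisenberg_bond n l m =
     on_site n l pauli_x * on_site n m pauli_x +
     on_site n l pauli_y * on_site n m pauli_y +
     on_site n l pauli_z * on_site n m pauli_z"

text \<open>Sites are numbered from \<open>0\<close> to \<open>n - 1\<close>; the bond from \<open>n - 1\<close> to \<open>0\<close> closes the ring.\<close>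

definition H_XXX :: "real \<Rightarrow> nat \<Rightarrow> complex mat" where
  "H_XXX J n =
     complex_of_real J \<cdot>\<^sub>m
       foldr (+) (map (\<lambda>l. heisenberg_bond n l (Suc l mod n)) [0..<n]) (0\<^sub>m (2 ^ n) (2 ^ n))"

end

theory Submission
  imports Defs
begin

text \<open>
  Let \<open>\<rho>\<close> be a \<open>k\<close>-extendible state with \<open>H \<rho> = E \<rho>\<close>, and let \<open>\<sigma>\<close> extend it at the site \<open>l\<close>.
  The marginals of \<open>\<sigma>\<close> determine the trace of \<open>(H\<^sub>i - E) \<sigma> (H\<^sub>i - E)\<close>, where \<open>H\<^sub>i\<close> is the Hamiltonian
  with the copy \<open>B\<^sub>i\<close> in the role of site \<open>l\<close>; hence \<open>H\<^sub>i \<sigma> = E \<sigma>\<close> for every \<open>i\<close>, so the coupling of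
  \<open>B\<^sub>i\<close> to the two neighbours of \<open>l\<close> acts on \<open>\<sigma>\<close> in the same way for all \<open>i\<close>. For three copies this
  forces a linear relation between swaps of \<open>B\<^sub>0\<close> and its neighbours, which descends to \<open>\<rho>\<close> and
  implies that the two bonds at \<open>l\<close> have nonnegative total energy. Summing over all sites gives
  \<open>E \<ge> 0\<close>. But the smallest eigenvalue of \<open>H\<close> is negative: \<open>H\<close> is traceless and has the positive
  eigenvalue \<open>J n\<close>. A bond acts as \<open>2 swap - 1\<close>, so all operators are combinations of
  transpositions of configurations.
\<close>

section \<open>Positive semidefinite matrices\<close>

definition qform :: "nat \<Rightarrow> complex mat \<Rightarrow> (nat \<Rightarrow> complex) \<Rightarrow> complex" where
  "qform d \<sigma> v = (\<Sum>i<d. \<Sum>j<d. cnj (v i) * \<sigma> $$ (i, j) * v j)"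

lemma density_operator_qform_nonneg:
  assumes "density_operator d \<sigma>"
  shows "0 \<le> qform d \<sigma> v"
proof -
  have c: "\<sigma> \<in> carrier_mat d d" using assms by (simp add: density_operator_def)
  have "0 \<le> (\<sigma> *\<^sub>v vec d v) \<bullet>c vec d v"
    using assms by (simp add: density_operator_def)
  also have "(\<sigma> *\<^sub>v vec d v) \<bullet>c vec d v = qform d \<sigma> v"
    using c by (simp add: scalar_prod_def qform_def atLeast0LessThan sum_distrib_left
        sum_distrib_right mult_ac)
  finally show ?thesis .
qed

lemma density_operator_hermitian:
  assumes "density_operator d \<sigma>" "i < d" "j < d"
  shows "\<sigma> $$ (j, i) = cnj (\<sigma> $$ (i, j))"
proof -
  have c: "\<sigma> \<in> carrier_mat d d" and a: "mat_adjoint \<sigma> = \<sigma>"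
    using assms by (auto simp: density_operator_def)
  have "mat_adjoint \<sigma> $$ (j, i) = cnj (\<sigma> $$ (i, j))"
    using c assms(2,3) by (simp add: mat_adjoint_def mat_of_rows_def)
  then show ?thesis using a by simp
qed

text \<open>With \<open>\<beta>\<close> the \<open>s\<close>-th entry of \<open>\<sigma> v\<close>,
  the form at \<open>r v - \<beta> e_s\<close> is affine in \<open>r\<close> with slope
  \<open>- 2 |\<beta>|\<^sup>2\<close>. It would become negative for large \<open>r\<close> unless
  \<open>\<beta> = 0\<close>.\<close>

lemma qform_zero_imp_kernel:
  assumes \<sigma>: "density_operator d \<sigma>" and z: "qform d \<sigma> v = 0" and s: "s < d"
  shows "(\<Sum>j<d. \<sigma> $$ (s, j) * v j) = 0"
proof -
  define \<beta> where "\<beta> = (\<Sum>j<d. \<sigma> $$ (s, j) * v j)"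
  define t where "t = Re (\<sigma> $$ (s, s))"
  have ts: "\<sigma> $$ (s, s) = complex_of_real t"
    using density_operator_hermitian[OF \<sigma> s s] unfolding t_def
    by (simp add: complex_eq_iff)
  have \<beta>': "(\<Sum>i<d. cnj (v i) * \<sigma> $$ (i, s)) = cnj \<beta>"
    unfolding \<beta>_def cnj_sum
    by (rule sum.cong[OF refl]) (simp add: density_operator_hermitian[OF \<sigma> s] mult.commute)
  have expand: "qform d \<sigma> (\<lambda>j. complex_of_real r * v j - (if j = s then \<beta> else 0))
      = complex_of_real ((t - 2 * r) * (cmod \<beta>)\<^sup>2)" for r
  proof -
    have "qform d \<sigma> (\<lambda>j. complex_of_real r * v j - (if j = s then \<beta> else 0)) =
      (\<Sum>i<d. \<Sum>j<d. of_real r * of_real r * (cnj (v i) * \<sigma> $$ (i, j) * v j)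
        - (if j = s then of_real r * \<beta> * (cnj (v i) * \<sigma> $$ (i, s)) else 0)
        - (if i = s then of_real r * cnj \<beta> * (\<sigma> $$ (s, j) * v j) else 0)
        + (if j = s then (if i = s then cnj \<beta> * \<beta> * \<sigma> $$ (s, s) else 0) else 0))"
      unfolding qform_def by (intro sum.cong refl) (auto simp: algebra_simps)
    also have "\<dots> = of_real r * of_real r * qform d \<sigma> v
        - of_real r * \<beta> * (\<Sum>i<d. cnj (v i) * \<sigma> $$ (i, s))
        - (\<Sum>i<d. \<Sum>j<d. if i = s then of_real r * cnj \<beta> * (\<sigma> $$ (s, j) * v j) else 0)
        + cnj \<beta> * \<beta> * \<sigma> $$ (s, s)"
      using s by (simp add: sum.distrib sum_subtractf qform_def sum_distrib_left)
    also have "(\<Sum>i<d. \<Sum>j<d. if i = s then of_real r * cnj \<beta> * (\<sigma> $$ (s, j) * v j) else 0)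
        = (\<Sum>j<d. of_real r * cnj \<beta> * (\<sigma> $$ (s, j) * v j))"
      by (subst sum.swap) (use s in simp)
    also have "\<dots> = of_real r * cnj \<beta> * \<beta>"
      by (simp add: \<beta>_def sum_distrib_left)
    also have "of_real r * of_real r * qform d \<sigma> v
        - of_real r * \<beta> * (\<Sum>i<d. cnj (v i) * \<sigma> $$ (i, s))
        - of_real r * cnj \<beta> * \<beta> + cnj \<beta> * \<beta> * \<sigma> $$ (s, s)
      = (of_real t - 2 * of_real r) * (\<beta> * cnj \<beta>)"
      unfolding z \<beta>' ts by (simp add: algebra_simps)
    also have "\<dots> = complex_of_real ((t - 2 * r) * (cmod \<beta>)\<^sup>2)"
      by (simp only: complex_norm_square of_real_mult of_real_diff of_real_numeral)
    finally show ?thesis .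
  qed
  have ge: "0 \<le> (t - 2 * r) * (cmod \<beta>)\<^sup>2" for r
    using density_operator_qform_nonneg[OF \<sigma>, of "\<lambda>j. complex_of_real r * v j - (if j = s then \<beta> else 0)"]
    unfolding expand less_eq_complex_def by (simp only: Re_complex_of_real zero_complex.sel)
  \<comment> \<open>This \<open>r\<close> makes the factor \<open>t - 2 * r\<close> equal to
    \<open>- 2\<close>.\<close>
  from ge[of "t / 2 + 1"] have "2 * (cmod \<beta>)\<^sup>2 \<le> 0" by (simp add: algebra_simps)
  then have "cmod \<beta> = 0" by simp
  then show ?thesis by (simp add: \<beta>_def)
qed

text \<open>The points \<open>p t\<close> may coincide, as happens when a swap fixes a
  configuration; hence the vector is a sum of weighted point masses. Real weights are fixed by
  conjugation.\<close>

lemma qform_point_masses: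
  assumes "finite I" and p: "\<And>t. t \<in> I \<Longrightarrow> p t < d"
  shows "qform d \<sigma> (\<lambda>j. \<Sum>t\<in>I. if p t = j then complex_of_real (m t) else 0)
    = (\<Sum>t\<in>I. \<Sum>u\<in>I. of_real (m t) * of_real (m u) * \<sigma> $$ (p t, p u))"
proof -
  define w where "w t j = (if p t = j then complex_of_real (m t) else 0)" for t j
  have cw: "cnj (w t j) = w t j" for t j by (simp add: w_def)
  have "qform d \<sigma> (\<lambda>j. \<Sum>t\<in>I. w t j)
    = (\<Sum>i<d. \<Sum>j<d. \<Sum>t\<in>I. \<Sum>u\<in>I. w t i * \<sigma> $$ (i, j) * w u j)"
    unfolding qform_def cnj_sum cw
    by (intro sum.cong refl, subst sum_distrib_right, rule sum_product)
  also have "\<dots> = (\<Sum>i<d. \<Sum>t\<in>I. \<Sum>u\<in>I. \<Sum>j<d. w t i * \<sigma> $$ (i, j) * w u j)"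
    by (rule sum.cong[OF refl], subst sum.swap, rule sum.cong[OF refl], rule sum.swap)
  also have "\<dots> = (\<Sum>t\<in>I. \<Sum>u\<in>I. \<Sum>i<d. \<Sum>j<d. w t i * \<sigma> $$ (i, j) * w u j)"
    by (subst sum.swap, rule sum.cong[OF refl], rule sum.swap)
  also have "\<dots> = (\<Sum>t\<in>I. \<Sum>u\<in>I. of_real (m t) * of_real (m u) * \<sigma> $$ (p t, p u))"
  proof (rule sum.cong[OF refl], rule sum.cong[OF refl])
    fix t u assume tu: "t \<in> I" "u \<in> I"
    have "(\<Sum>j<d. w t i * \<sigma> $$ (i, j) * w u j) = w t i * \<sigma> $$ (i, p u) * of_real (m u)" for i
    proof -
      have "(\<Sum>j<d. w t i * \<sigma> $$ (i, j) * w u j)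
        = (\<Sum>j<d. if p u = j then w t i * \<sigma> $$ (i, j) * of_real (m u) else 0)"
        by (rule sum.cong[OF refl]) (simp add: w_def)
      then show ?thesis using p[OF tu(2)] by simp
    qed
    moreover have "(\<Sum>i<d. w t i * \<sigma> $$ (i, p u) * of_real (m u))
        = (\<Sum>i<d. if p t = i then of_real (m t) * \<sigma> $$ (i, p u) * of_real (m u) else 0)"
      by (rule sum.cong[OF refl]) (simp add: w_def)
    ultimately show "(\<Sum>i<d. \<Sum>j<d. w t i * \<sigma> $$ (i, j) * w u j)
       = complex_of_real (m t) * of_real (m u) * \<sigma> $$ (p t, p u)"
      using p[OF tu(1)] by simp
  qed
  finally show ?thesis by (simp add: w_def)
qed

lemma density_operator_point_masses_nonneg:
  fixes m :: "'i \<Rightarrow> real"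
  assumes "density_operator d \<sigma>" "finite I" "\<And>t. t \<in> I \<Longrightarrow> p t < d"
  shows "0 \<le> (\<Sum>t\<in>I. \<Sum>u\<in>I. of_real (m t) * of_real (m u) * \<sigma> $$ (p t, p u))"
  using density_operator_qform_nonneg[OF assms(1),
    of "\<lambda>j. \<Sum>t\<in>I. if p t = j then complex_of_real (m t) else 0"]
  by (simp add: qform_point_masses[OF assms(2,3)])

text \<open>Hermitian symmetry moves the points \<open>p t\<close> to the row index, where operators
  acting from the left place them.\<close>

lemma density_operator_point_masses_kernel:
  fixes m :: "'i \<Rightarrow> real"
  assumes \<sigma>: "density_operator d \<sigma>" and I: "finite I" "\<And>t. t \<in> I \<Longrightarrow> p t < d"
    and z: "(\<Sum>t\<in>I. \<Sum>u\<in>I. of_real (m t) * of_real (m u) * \<sigma> $$ (p t, p u)) = 0"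
    and s: "s < d"
  shows "(\<Sum>t\<in>I. of_real (m t) * \<sigma> $$ (p t, s)) = 0"
proof -
  have "(\<Sum>j<d. \<sigma> $$ (s, j) * (\<Sum>t\<in>I. if p t = j then complex_of_real (m t) else 0)) = 0"
    by (rule qform_zero_imp_kernel[OF \<sigma> _ s]) (simp add: qform_point_masses[OF I] z)
  moreover have "(\<Sum>j<d. \<sigma> $$ (s, j) * (\<Sum>t\<in>I. if p t = j then complex_of_real (m t) else 0))
    = (\<Sum>t\<in>I. of_real (m t) * \<sigma> $$ (s, p t))"
    unfolding sum_distrib_left
    by (subst sum.swap, intro sum.cong refl) (simp add: if_distrib I(2) cong: if_cong)
  ultimately have "cnj (\<Sum>t\<in>I. of_real (m t) * \<sigma> $$ (s, p t)) = 0" by simp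
  moreover have "cnj (\<Sum>t\<in>I. of_real (m t) * \<sigma> $$ (s, p t)) = (\<Sum>t\<in>I. of_real (m t) * \<sigma> $$ (p t, s))"
    using density_operator_hermitian[OF \<sigma> s I(2)] by (simp add: cnj_sum)
  ultimately show ?thesis by simp
qed

section \<open>The Hamiltonian on configurations\<close>

text \<open>Site \<open>0\<close> is the leftmost tensor factor, hence the most significant bit.\<close>

primrec enc :: "nat \<Rightarrow> (nat \<Rightarrow> bool) \<Rightarrow> nat" where
  "enc 0 c = 0"
| "enc (Suc n) c = enc n c * 2 + of_bool (c n)"

lemma enc_less: "enc n c < 2 ^ n"
  by (induction n) auto

lemma enc_cong: "(\<And>i. i < n \<Longrightarrow> c i = d i) \<Longrightarrow> enc n c = enc n d"
  by (induction n) auto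

lemma enc_inject: "enc n c = enc n d \<longleftrightarrow> (\<forall>i<n. c i = d i)"
proof (induction n)
  case (Suc n)
  have "enc (Suc n) c = enc (Suc n) d \<longleftrightarrow> enc n c = enc n d \<and> c n = d n"
    by (cases "c n"; cases "d n"; simp; presburger)
  then show ?case using Suc by (auto simp: less_Suc_eq)
qed simp

lemma enc_add: "enc (m + n) c = enc m c * 2 ^ n + enc n (\<lambda>i. c (m + i))"
  by (induction n) (auto simp: algebra_simps)

text \<open>Left block, bit, right block: the grouping of tensor factors used by
  \<open>on_site\<close> and \<open>mid_to_last\<close>.\<close>

lemma enc_site:
  assumes "l < n"
  shows "enc n c = (enc l c * 2 + of_bool (c l)) * 2 ^ (n - 1 - l) + enc (n - 1 - l) (\<lambda>i. c (Suc l + i))"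
proof -
  have "n = Suc l + (n - 1 - l)" using assms by simp
  then have "enc n c = enc (Suc l + (n - 1 - l)) c" by simp
  then show ?thesis by (simp only: enc_add enc.simps)
qed

text \<open>Bits from position \<open>n\<close> on are fixed to \<open>False\<close>, so that each
  index below \<open>2 ^ n\<close> has exactly one representative, although \<open>enc n\<close>
  reads only the first \<open>n\<close> bits.\<close>

definition configs :: "nat \<Rightarrow> (nat \<Rightarrow> bool) set" where
  "configs n = {c. \<forall>i\<ge>n. \<not> c i}"

lemma enc_surj:
  assumes "i < 2 ^ n"
  shows "\<exists>c\<in>configs n. enc n c = i"
  using assms
proof (induction n arbitrary: i)
  case (Suc n)
  then have "i div 2 < 2 ^ n" by simp
  then obtain c where c: "c \<in> configs n" "enc n c = i div 2" using Suc.IH by blast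
  have "enc n (c(n := odd i)) = i div 2"
    using c(2) enc_cong[of n "c(n := odd i)" c] by simp
  then have "enc (Suc n) (c(n := odd i)) = i" by (simp add: of_bool_odd_eq_mod_2)
  moreover have "c(n := odd i) \<in> configs (Suc n)" using c(1) by (auto simp: configs_def)
  ultimately show ?case by blast
qed (auto simp: configs_def)

lemma bij_betw_enc: "bij_betw (enc n) (configs n) {..<2 ^ n}"
proof (intro bij_betw_imageI)
  show "inj_on (enc n) (configs n)"
    by (auto simp: inj_on_def enc_inject configs_def fun_eq_iff) (metis not_less)+
  show "enc n ` configs n = {..<2 ^ n}"
    using enc_surj enc_less by (fastforce simp: image_iff)
qed

lemma finite_configs: "finite (configs n)"
  using bij_betw_enc bij_betw_finite by blast

lemma sum_configs: "(\<Sum>c\<in>configs n. f (enc n c)) = (\<Sum>i<2 ^ n. f i)"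
  by (rule sum.reindex_bij_betw[OF bij_betw_enc])

section \<open>Tensor products and one-site operators in the configuration basis\<close>

lemma index_less:
  fixes x a b y :: nat
  assumes "x < a" "y < b"
  shows "x * b + y < a * b"
  using mult_le_mono1[of "Suc x" a b] assms by simp

lemma kron_index:
  assumes "A \<in> carrier_mat a a'" "B \<in> carrier_mat b b'" "x < a" "x' < a'" "y < b" "y' < b'"
  shows "(A \<otimes>\<^sub>m B) $$ (x * b + y, x' * b' + y') = A $$ (x, x') * B $$ (y, y')"
proof -
  show ?thesis
    using assms index_less[OF assms(3,5)] index_less[OF assms(4,6)] by (auto simp: kron_def)
qed

lemma kron_carrier:
  "A \<in> carrier_mat a a' \<Longrightarrow> B \<in> carrier_mat b b' \<Longrightarrow> A \<otimes>\<^sub>m B \<in> carrier_mat (a * b) (a' * b')"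
  by (auto simp: kron_def)

lemma on_site_carrier:
  assumes "P \<in> carrier_mat 2 2" "l < n"
  shows "on_site n l P \<in> carrier_mat (2 ^ n) (2 ^ n)"
proof -
  have "(2::nat) ^ n = 2 ^ (Suc l + (n - 1 - l))" using assms by simp
  then have "(2::nat) ^ n = 2 ^ l * (2 * 2 ^ (n - 1 - l))"
    by (simp only: power_add power_Suc mult_ac)
  then show ?thesis
    unfolding on_site_def
    using kron_carrier[OF one_carrier_mat kron_carrier[OF assms(1) one_carrier_mat]] by simp
qed

text \<open>The identity factors contribute Kronecker deltas on the blocks left and right of
  \<open>l\<close>, leaving an entry of \<open>P\<close>.\<close>

lemma on_site_index:
  assumes P: "P \<in> carrier_mat 2 2" and l: "l < n"
  shows "on_site n l P $$ (enc n c, enc n d) =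
    (if \<forall>i<n. i \<noteq> l \<longrightarrow> c i = d i then P $$ (of_bool (c l), of_bool (d l)) else 0)"
proof -
  define r where "r = n - 1 - l"
  let ?y = "\<lambda>c. enc r (\<lambda>i. c (Suc l + i))"
  have e: "enc n c = enc l c * (2 * 2 ^ r) + (of_bool (c l) * 2 ^ r + ?y c)" for c
    using enc_site[OF l] unfolding r_def by (simp add: algebra_simps)
  have b: "of_bool (c l) < (2::nat)" for c :: "nat \<Rightarrow> bool" by simp
  have lt: "of_bool (c l) * 2 ^ r + ?y c < 2 * 2 ^ r" for c
    using enc_less[of r "\<lambda>i. c (Suc l + i)"] by (cases "c l") auto
  have inner: "P \<otimes>\<^sub>m 1\<^sub>m (2 ^ r) \<in> carrier_mat (2 * 2 ^ r) (2 * 2 ^ r)"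
    by (rule kron_carrier[OF P one_carrier_mat])
  have "on_site n l P $$ (enc n c, enc n d) =
      1\<^sub>m (2 ^ l) $$ (enc l c, enc l d) *
      (P $$ (of_bool (c l), of_bool (d l)) * 1\<^sub>m (2 ^ r) $$ (?y c, ?y d))"
    unfolding on_site_def r_def[symmetric] e
    by (simp only: kron_index[OF one_carrier_mat inner enc_less enc_less lt lt]
        kron_index[OF P one_carrier_mat b b enc_less enc_less])
  also have "\<dots> = (if enc l c = enc l d \<and> ?y c = ?y d then P $$ (of_bool (c l), of_bool (d l)) else 0)"
    by (simp add: enc_less)
  also have "enc l c = enc l d \<and> ?y c = ?y d \<longleftrightarrow> (\<forall>i<n. i \<noteq> l \<longrightarrow> c i = d i)"
  proof -
    have "c i = d i" if "enc l c = enc l d" "?y c = ?y d" "i < n" "i \<noteq> l" for i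
    proof (cases "i < l")
      case True then show ?thesis using that by (simp add: enc_inject)
    next
      case False
      define j where "j = i - Suc l"
      have "i = Suc l + j" "j < r" using False that(3,4) unfolding r_def j_def by auto
      then show ?thesis using that(2) by (simp add: enc_inject)
    qed
    moreover have "enc l c = enc l d" "?y c = ?y d" if "\<forall>i<n. i \<noteq> l \<longrightarrow> c i = d i"
      using that l by (auto simp: enc_inject r_def)
    ultimately show ?thesis by blast
  qed
  finally show ?thesis .
qed

lemma on_site_mult_vec:
  assumes P: "P \<in> carrier_mat 2 2" and l: "l < n" and v: "v \<in> carrier_vec (2 ^ n)"
  shows "(on_site n l P *\<^sub>v v) $ enc n c =
    P $$ (of_bool (c l), 0) * v $ enc n (c(l := False)) + P $$ (of_bool (c l), 1) * v $ enc n (c(l := True))"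
proof -
  let ?M = "on_site n l P"
  let ?j = "\<lambda>b. enc n (c(l := b))"
  have M: "?M \<in> carrier_mat (2 ^ n) (2 ^ n)" by (rule on_site_carrier[OF P l])
  have neq: "?j False \<noteq> ?j True" using l by (auto simp: enc_inject)
  have "(?M *\<^sub>v v) $ enc n c = (\<Sum>j<2 ^ n. ?M $$ (enc n c, j) * v $ j)"
    using M v by (simp add: enc_less scalar_prod_def atLeast0LessThan)
  also have "\<dots> = (\<Sum>j\<in>{?j False, ?j True}. ?M $$ (enc n c, j) * v $ j)"
  proof (rule sum.mono_neutral_right)
    show "\<forall>j\<in>{..<2 ^ n} - {?j False, ?j True}. ?M $$ (enc n c, j) * v $ j = 0"
    proof
      fix j assume j: "j \<in> {..<2 ^ n} - {?j False, ?j True}"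
      then obtain d where d: "enc n d = j" using enc_surj by blast
      have "\<not> (\<forall>i<n. i \<noteq> l \<longrightarrow> c i = d i)"
      proof
        assume "\<forall>i<n. i \<noteq> l \<longrightarrow> c i = d i"
        then have "enc n d = ?j (d l)" by (simp add: enc_inject)
        then show False using j d by (cases "d l") auto
      qed
      then have "?M $$ (enc n c, j) = 0"
        unfolding d[symmetric] on_site_index[OF P l] by (rule if_not_P)
      then show "?M $$ (enc n c, j) * v $ j = 0" by simp
    qed
  qed (auto simp: enc_less)
  also have "\<dots> = P $$ (of_bool (c l), 0) * v $ ?j False + P $$ (of_bool (c l), 1) * v $ ?j True"
    using neq by (simp add: on_site_index[OF P l])
  finally show ?thesis .
qed

section \<open>Swaps and Heisenberg bonds\<close>

text \<open>For \<open>l = m\<close> this is the identity, which later lets a scalar term be written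
  as one more swap.\<close>

definition swp :: "nat \<Rightarrow> nat \<Rightarrow> (nat \<Rightarrow> bool) \<Rightarrow> nat \<Rightarrow> bool" where
  "swp l m c = c(l := c m, m := c l)"

lemma swp_swp [simp]: "swp l m (swp l m c) = c"
  by (auto simp: swp_def)

lemma swp_configs: "l < n \<Longrightarrow> m < n \<Longrightarrow> c \<in> configs n \<Longrightarrow> swp l m c \<in> configs n"
  by (auto simp: swp_def configs_def)

lemma pauli_carrier: "pauli_x \<in> carrier_mat 2 2" "pauli_y \<in> carrier_mat 2 2" "pauli_z \<in> carrier_mat 2 2"
  by (auto simp: pauli_x_def pauli_y_def pauli_z_def mat_of_rows_list_def)

lemma pauli_index:
  "pauli_x $$ (0, 0) = 0" "pauli_x $$ (0, Suc 0) = 1" "pauli_x $$ (Suc 0, 0) = 1" "pauli_x $$ (Suc 0, Suc 0) = 0"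
  "pauli_y $$ (0, 0) = 0" "pauli_y $$ (0, Suc 0) = - \<i>" "pauli_y $$ (Suc 0, 0) = \<i>" "pauli_y $$ (Suc 0, Suc 0) = 0"
  "pauli_z $$ (0, 0) = 1" "pauli_z $$ (0, Suc 0) = 0" "pauli_z $$ (Suc 0, 0) = 0" "pauli_z $$ (Suc 0, Suc 0) = - 1"
  by (auto simp: pauli_x_def pauli_y_def pauli_z_def mat_of_rows_list_def)

lemma heisenberg_bond_carrier:
  assumes "l < n" "m < n"
  shows "heisenberg_bond n l m \<in> carrier_mat (2 ^ n) (2 ^ n)"
  unfolding heisenberg_bond_def using assms
  by (intro add_carrier_mat mult_carrier_mat[of _ _ "2 ^ n"] on_site_carrier pauli_carrier)

text \<open>Checked on the four values of the bits at \<open>l\<close> and \<open>m\<close>.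
  Distinct sites matter: on a single site the bond is three times the identity.\<close>

lemma heisenberg_bond_mult_vec:
  assumes l: "l < n" and m: "m < n" and lm: "l \<noteq> m" and v: "v \<in> carrier_vec (2 ^ n)"
  shows "(heisenberg_bond n l m *\<^sub>v v) $ enc n c = 2 * v $ enc n (swp l m c) - v $ enc n c"
proof -
  have prod: "on_site n l P * on_site n m P \<in> carrier_mat (2 ^ n) (2 ^ n)"
    "(on_site n l P * on_site n m P *\<^sub>v v) $ enc n c =
     P $$ (of_bool (c l), 0) * (P $$ (of_bool (c m), 0) * v $ enc n (c(l := False, m := False))
       + P $$ (of_bool (c m), 1) * v $ enc n (c(l := False, m := True)))
     + P $$ (of_bool (c l), 1) * (P $$ (of_bool (c m), 0) * v $ enc n (c(l := True, m := False))
       + P $$ (of_bool (c m), 1) * v $ enc n (c(l := True, m := True)))"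
    if P: "P \<in> carrier_mat 2 2" for P
  proof -
    have c: "on_site n l P \<in> carrier_mat (2 ^ n) (2 ^ n)" "on_site n m P \<in> carrier_mat (2 ^ n) (2 ^ n)"
      using on_site_carrier P l m by auto
    then show "on_site n l P * on_site n m P \<in> carrier_mat (2 ^ n) (2 ^ n)" by (rule mult_carrier_mat)
    have w: "on_site n m P *\<^sub>v v \<in> carrier_vec (2 ^ n)" using c(2) v by simp
    show "(on_site n l P * on_site n m P *\<^sub>v v) $ enc n c =
     P $$ (of_bool (c l), 0) * (P $$ (of_bool (c m), 0) * v $ enc n (c(l := False, m := False))
       + P $$ (of_bool (c m), 1) * v $ enc n (c(l := False, m := True)))
     + P $$ (of_bool (c l), 1) * (P $$ (of_bool (c m), 0) * v $ enc n (c(l := True, m := False))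
       + P $$ (of_bool (c m), 1) * v $ enc n (c(l := True, m := True)))"
      using lm unfolding assoc_mult_mat_vec[OF c v] on_site_mult_vec[OF P l w] on_site_mult_vec[OF P m v]
      by simp
  qed
  let ?X = "on_site n l pauli_x * on_site n m pauli_x"
  let ?Y = "on_site n l pauli_y * on_site n m pauli_y"
  let ?Z = "on_site n l pauli_z * on_site n m pauli_z"
  note cs = prod(1)[OF pauli_carrier(1)] prod(1)[OF pauli_carrier(2)] prod(1)[OF pauli_carrier(3)]
  have "(heisenberg_bond n l m *\<^sub>v v) $ enc n c =
    (?X *\<^sub>v v) $ enc n c + (?Y *\<^sub>v v) $ enc n c + (?Z *\<^sub>v v) $ enc n c"
    unfolding heisenberg_bond_def
      add_mult_distrib_mat_vec[OF add_carrier_mat[OF cs(2)] cs(3) v]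
      add_mult_distrib_mat_vec[OF cs(1,2) v]
    using pauli_carrier[THEN on_site_carrier[OF _ l], THEN carrier_matD(1)] by (simp add: enc_less)
  also have "\<dots> = 2 * v $ enc n (swp l m c) - v $ enc n c"
    using lm fun_upd_triv[of c l] fun_upd_triv[of c m] unfolding prod(2)[OF pauli_carrier(1)] prod(2)[OF pauli_carrier(2)] prod(2)[OF pauli_carrier(3)]
    by (cases "c l"; cases "c m") (auto simp: pauli_index swp_def fun_upd_idem)
  finally show ?thesis .
qed

lemma foldr_plus_mat:
  assumes "\<And>x. x \<in> set xs \<Longrightarrow> f x \<in> carrier_mat d d" and "v \<in> carrier_vec d" "i < d"
  shows "foldr (+) (map f xs) (0\<^sub>m d d) \<in> carrier_mat d d"
    and "(foldr (+) (map f xs) (0\<^sub>m d d) *\<^sub>v v) $ i = (\<Sum>x\<leftarrow>xs. (f x *\<^sub>v v) $ i)"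
proof -
  have "foldr (+) (map f xs) (0\<^sub>m d d) \<in> carrier_mat d d \<and>
    (foldr (+) (map f xs) (0\<^sub>m d d) *\<^sub>v v) $ i = (\<Sum>x\<leftarrow>xs. (f x *\<^sub>v v) $ i)"
    using assms(1)
  proof (induction xs)
    case Nil
    then show ?case using assms(2,3) by (simp add: scalar_prod_def)
  next
    case (Cons x xs)
    then have 1: "f x \<in> carrier_mat d d" and 2: "foldr (+) (map f xs) (0\<^sub>m d d) \<in> carrier_mat d d"
      by auto
    show ?case
      using Cons 1 2 assms(2,3) by (simp add: add_mult_distrib_mat_vec[OF 1 2 assms(2)])
  qed
  then show "foldr (+) (map f xs) (0\<^sub>m d d) \<in> carrier_mat d d"
    and "(foldr (+) (map f xs) (0\<^sub>m d d) *\<^sub>v v) $ i = (\<Sum>x\<leftarrow>xs. (f x *\<^sub>v v) $ i)"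
    by auto
qed

lemma H_XXX_carrier: "H_XXX J n \<in> carrier_mat (2 ^ n) (2 ^ n)"
  unfolding H_XXX_def
  by (intro smult_carrier_mat foldr_plus_mat(1)[of _ _ _ "0\<^sub>v (2 ^ n)" 0] heisenberg_bond_carrier) auto

lemma H_XXX_mult_vec:
  assumes n: "2 \<le> n" and v: "v \<in> carrier_vec (2 ^ n)"
  shows "(H_XXX J n *\<^sub>v v) $ enc n c =
    J * (\<Sum>l<n. 2 * v $ enc n (swp l (Suc l mod n) c) - v $ enc n c)"
proof -
  let ?f = "\<lambda>l. heisenberg_bond n l (Suc l mod n)"
  let ?S = "foldr (+) (map ?f [0..<n]) (0\<^sub>m (2 ^ n) (2 ^ n))"
  have f: "?f l \<in> carrier_mat (2 ^ n) (2 ^ n)" if "l \<in> set [0..<n]" for l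
    using that by (intro heisenberg_bond_carrier) auto
  \<comment> \<open>For \<open>n \<ge> 2\<close> the bond closing the ring also joins two different
    sites.\<close>
  have ne: "l \<noteq> Suc l mod n" if "l < n" for l using that n by (cases "Suc l = n") auto
  have S: "?S \<in> carrier_mat (2 ^ n) (2 ^ n)"
    by (rule foldr_plus_mat(1)[OF f v enc_less])
  have "(H_XXX J n *\<^sub>v v) $ enc n c = J * (?S *\<^sub>v v) $ enc n c"
    unfolding H_XXX_def using S v 
    by (simp add: enc_less scalar_prod_def sum_distrib_left mult.assoc)
  also have "(?S *\<^sub>v v) $ enc n c = (\<Sum>l\<leftarrow>[0..<n]. (?f l *\<^sub>v v) $ enc n c)"
    by (rule foldr_plus_mat(2)[OF f v enc_less])
  also have "\<dots> = (\<Sum>l<n. (?f l *\<^sub>v v) $ enc n c)"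
    by (simp add: sum_list_distinct_conv_sum_set atLeast0LessThan)
  also have "\<dots> = (\<Sum>l<n. 2 * v $ enc n (swp l (Suc l mod n) c) - v $ enc n c)"
    by (intro sum.cong refl heisenberg_bond_mult_vec[OF _ _ ne v]) auto
  finally show ?thesis .
qed

section \<open>The ground state energy\<close>

lemma mat_trace_mult_comm:
  assumes "A \<in> carrier_mat n m" "B \<in> carrier_mat m n"
  shows "mat_trace (A * B) = mat_trace (B * A)"
proof -
  have "mat_trace (A * B) = (\<Sum>i<n. \<Sum>j<m. A $$ (i, j) * B $$ (j, i))"
    using assms by (simp add: mat_trace_def scalar_prod_def atLeast0LessThan)
  also have "\<dots> = (\<Sum>j<m. \<Sum>i<n. B $$ (j, i) * A $$ (i, j))"
    by (subst sum.swap) (simp add: mult.commute)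
  also have "\<dots> = mat_trace (B * A)"
    using assms by (simp add: mat_trace_def scalar_prod_def atLeast0LessThan)
  finally show ?thesis .
qed

text \<open>The characteristic polynomial splits over the complex numbers, the Schur form has its
  roots on the diagonal, and similarity preserves the trace. The list \<open>es\<close> carries
  multiplicities.\<close>

lemma mat_trace_eq_sum_eigenvalues:
  assumes A: "A \<in> carrier_mat n n"
  obtains es where "\<And>e. eigenvalue A e \<longleftrightarrow> e \<in> set es" "mat_trace A = sum_list es"
proof -
  obtain es where cp: "char_poly A = (\<Prod>e\<leftarrow>es. [:- e, 1:])"
    using char_poly_factorized[OF A] by blast
  obtain B P Q where BPQ: "schur_decomposition A es = (B, P, Q)"
    by (cases "schur_decomposition A es")
  have sim: "similar_mat_wit A B P Q" and diag: "diag_mat B = es"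
    using schur_decomposition[OF A cp BPQ] by auto
  note w = similar_mat_witD2[OF A sim]
  have "mat_trace A = mat_trace (P * (B * Q))" using w by (simp add: assoc_mult_mat[of P n n B n Q n])
  also have "\<dots> = mat_trace ((B * Q) * P)" using w by (intro mat_trace_mult_comm) auto
  also have "(B * Q) * P = B" using w by (simp add: assoc_mult_mat[of B n n Q n P n])
  also have "mat_trace B = sum_list es"
    using w unfolding diag[symmetric]
    by (simp add: mat_trace_def diag_mat_def sum_list_distinct_conv_sum_set atLeast0LessThan)
  finally have "mat_trace A = sum_list es" .
  moreover have "eigenvalue A e \<longleftrightarrow> e \<in> set es" for e
    unfolding eigenvalue_root_char_poly[OF A] cp by (simp add: poly_prod_list prod_list_zero_iff image_iff)
  ultimately show thesis using that by blast
qed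

lemma enc_swp_eq_iff:
  assumes "l < n" "m < n"
  shows "enc n (swp l m c) = enc n c \<longleftrightarrow> c l = c m"
proof
  assume "enc n (swp l m c) = enc n c"
  then have "swp l m c m = c m" using assms(2) by (simp add: enc_inject)
  then show "c l = c m" by (simp add: swp_def)
next
  assume "c l = c m"
  then have "swp l m c = c" by (simp add: swp_def fun_eq_iff)
  then show "enc n (swp l m c) = enc n c" by simp
qed

text \<open>Up to the factor \<open>J\<close>, a bond contributes \<open>1\<close> to a diagonal
  entry if its two spins agree and \<open>- 1\<close> otherwise. Flipping the spin at
  \<open>l\<close> exchanges the two cases, so every bond is traceless.\<close>

lemma mat_trace_H_XXX:
  assumes n: "2 \<le> n"
  shows "mat_trace (H_XXX J n) = 0"
proof -
  have H: "H_XXX J n \<in> carrier_mat (2 ^ n) (2 ^ n)" by (rule H_XXX_carrier)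
  have diag: "H_XXX J n $$ (enc n c, enc n c) = complex_of_real J * (\<Sum>l<n. 2 * of_bool (c l = c (Suc l mod n)) - 1)" for c
  proof -
    let ?u = "unit_vec (2 ^ n) (enc n c) :: complex vec"
    have "H_XXX J n $$ (enc n c, enc n c) = (H_XXX J n *\<^sub>v ?u) $ enc n c"
      using H by (simp add: enc_less)
    also have "\<dots> = complex_of_real J * (\<Sum>l<n. 2 * ?u $ enc n (swp l (Suc l mod n) c)
        - ?u $ enc n c)"
      by (rule H_XXX_mult_vec[OF n]) simp
    also have "(\<Sum>l<n. 2 * ?u $ enc n (swp l (Suc l mod n) c)
        - ?u $ enc n c)
      = (\<Sum>l<n. 2 * of_bool (c l = c (Suc l mod n)) - (1::complex))"
    proof (rule sum.cong[OF refl])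
      fix l assume l: "l \<in> {..<n}"
      have "enc n (swp l (Suc l mod n) c) = enc n c \<longleftrightarrow> c l = c (Suc l mod n)"
        using l enc_swp_eq_iff by simp
      then show "2 * ?u $ enc n (swp l (Suc l mod n) c)
        - ?u $ enc n c = 2 * of_bool (c l = c (Suc l mod n)) - (1::complex)"
        by (cases "c l = c (Suc l mod n)") (simp_all only: index_unit_vec enc_less if_True if_False simp_thms of_bool_eq)
    qed
    finally show ?thesis .
  qed
  have zero: "(\<Sum>c\<in>configs n. 2 * of_bool (c l = c (Suc l mod n)) - (1::complex)) = 0" if l: "l < n" for l
  proof -
    have ne: "l \<noteq> Suc l mod n" using l n by (cases "Suc l = n") auto
    let ?g = "\<lambda>c. 2 * of_bool (c l = c (Suc l mod n)) - (1::complex)"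
    have "(\<Sum>c\<in>configs n. ?g c) = (\<Sum>c\<in>configs n. ?g (c(l := \<not> c l)))"
      by (rule sum.reindex_bij_witness[of _ "\<lambda>c. c(l := \<not> c l)" "\<lambda>c. c(l := \<not> c l)"])
         (use l in \<open>auto simp: configs_def\<close>)
    also have "\<dots> = (\<Sum>c\<in>configs n. - ?g c)"
      using ne by (intro sum.cong) auto
    finally show ?thesis by (simp only: sum_negf) (simp add: eq_neg_iff_add_eq_0)
  qed
  have "mat_trace (H_XXX J n) = (\<Sum>c\<in>configs n. H_XXX J n $$ (enc n c, enc n c))"
    using H sum_configs[of "\<lambda>i. H_XXX J n $$ (i, i)" n] by (simp add: mat_trace_def)
  also have "\<dots> = complex_of_real J * (\<Sum>c\<in>configs n. \<Sum>l<n. 2 * of_bool (c l = c (Suc l mod n)) - (1::complex))"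
    by (simp only: diag sum_distrib_left)
  also have "\<dots> = 0" by (subst sum.swap) (simp add: zero)
  finally show ?thesis .
qed

text \<open>Every swap preserves the constant vector, so each of the \<open>n\<close> bonds acts on
  it as \<open>1\<close>.\<close>

lemma eigenvalue_H_XXX_ferromagnetic:
  assumes n: "2 \<le> n"
  shows "eigenvalue (H_XXX J n) (complex_of_real (J * n))"
proof -
  let ?v = "vec (2 ^ n) (\<lambda>_. 1) :: complex vec"
  have H: "H_XXX J n \<in> carrier_mat (2 ^ n) (2 ^ n)" by (rule H_XXX_carrier)
  have "H_XXX J n *\<^sub>v ?v = complex_of_real (J * n) \<cdot>\<^sub>v ?v"
  proof (rule eq_vecI)
    fix i assume "i < dim_vec (complex_of_real (J * n) \<cdot>\<^sub>v ?v)"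
    then have i: "i < 2 ^ n" by simp
    then obtain c where c: "enc n c = i" using enc_surj by blast
    show "(H_XXX J n *\<^sub>v ?v) $ i = (complex_of_real (J * n) \<cdot>\<^sub>v ?v) $ i"
      unfolding c[symmetric] by (subst H_XXX_mult_vec[OF n]) (simp_all add: enc_less)
  qed (use H in simp)
  moreover have "?v \<noteq> 0\<^sub>v (2 ^ n)"
    by (metis index_vec index_zero_vec(1) zero_neq_one zero_less_power zero_less_numeral)
  ultimately have "eigenvector (H_XXX J n) ?v (complex_of_real (J * n))"
    using H by (simp add: eigenvector_def)
  then show ?thesis unfolding eigenvalue_def by blast
qed

text \<open>Otherwise all eigenvalues have nonnegative real part, and the vanishing trace makes
  these real parts zero, against the eigenvalue \<open>J * n\<close>.\<close>

lemma smallest_eigenvalue_H_XXX_neg: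
  assumes n: "2 \<le> n" and J: "J > 0" and E: "smallest_eigenvalue (H_XXX J n) E"
  shows "E < 0"
proof (rule ccontr)
  assume "\<not> E < 0"
  obtain es where es: "\<And>e. eigenvalue (H_XXX J n) e \<longleftrightarrow> e \<in> set es"
    and tr: "mat_trace (H_XXX J n) = sum_list es"
    using mat_trace_eq_sum_eigenvalues[OF H_XXX_carrier] by blast
  have nonneg: "0 \<le> Re e" if "e \<in> set es" for e
    using E \<open>\<not> E < 0\<close> that unfolding smallest_eigenvalue_def es by force
  have "Re (sum_list es) = sum_list (map Re es)" by (induction es) auto
  then have "sum_list (map Re es) = 0" using tr mat_trace_H_XXX[OF n] by simp
  moreover have "\<And>x. x \<in> set (map Re es) \<Longrightarrow> 0 \<le> x" using nonneg by auto
  ultimately have "\<forall>x\<in>set (map Re es). x = 0" using sum_list_nonneg_eq_0_iff by blast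
  moreover have "complex_of_real (J * n) \<in> set es"
    using eigenvalue_H_XXX_ferromagnetic[OF n] es by blast
  ultimately show False using J n by force
qed

text \<open>This is \<open>H \<rho> = E \<rho>\<close> read entrywise; moving the \<open>- 1\<close>
  of each of the \<open>n\<close> bonds to the right produces \<open>J * n + E\<close>.\<close>

lemma ground_state_H_XXX:
  assumes n: "2 \<le> n" and J: "J > 0" and \<rho>: "ground_state (H_XXX J n) \<rho>"
  obtains E where "E < 0"
    and "\<And>c s. s < 2 ^ n \<Longrightarrow>
      (\<Sum>l<n. complex_of_real (2 * J) * \<rho> $$ (enc n (swp l (Suc l mod n) c), s)) = complex_of_real (J * n + E) * \<rho> $$ (enc n c, s)"
proof -
  have dim: "dim_row (H_XXX J n) = 2 ^ n" using H_XXX_carrier by blast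
  obtain E where E: "smallest_eigenvalue (H_XXX J n) E"
    and eig: "\<And>v. v \<in> carrier_vec (2 ^ n) \<Longrightarrow>
      H_XXX J n *\<^sub>v (\<rho> *\<^sub>v v) = complex_of_real E \<cdot>\<^sub>v (\<rho> *\<^sub>v v)"
    and c: "\<rho> \<in> carrier_mat (2 ^ n) (2 ^ n)"
    using \<rho> unfolding ground_state_def dim density_operator_def by auto
  have "(\<Sum>l<n. complex_of_real (2 * J) * \<rho> $$ (enc n (swp l (Suc l mod n) c), s)) = complex_of_real (J * n + E) * \<rho> $$ (enc n c, s)"
    if s: "s < 2 ^ n" for c s
  proof -
    let ?w = "\<rho> *\<^sub>v unit_vec (2 ^ n) s"
    have w: "?w \<in> carrier_vec (2 ^ n)" using c by simp
    have ind: "?w $ enc n d = \<rho> $$ (enc n d, s)" for d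
      using c s by (simp add: enc_less)
    have "J * (\<Sum>l<n. 2 * ?w $ enc n (swp l (Suc l mod n) c) - ?w $ enc n c)
      = (complex_of_real E \<cdot>\<^sub>v ?w) $ enc n c"
      unfolding H_XXX_mult_vec[OF n w, symmetric] by (subst eig) simp_all
    also have "\<dots> = E * ?w $ enc n c" using w enc_less[of n c] by (metis carrier_vecD index_smult_vec(1))
    finally show ?thesis unfolding ind
      by (simp add: sum_subtractf algebra_simps sum_distrib_left)
  qed
  then show thesis using that smallest_eigenvalue_H_XXX_neg[OF n J E] by blast
qed

section \<open>Three copies coupled to two sites\<close>

text \<open>
  With Pauli matrices, \<open>h\<^sub>i = (\<sigma>\<^sub>p + \<sigma>\<^sub>q) \<bullet> \<sigma>\<^sub>i = 2 (swap\<^sub>p\<^sub>i + swap\<^sub>q\<^sub>i - 1)\<close> and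
  \<open>Q = \<bar>\<sigma>\<^sub>p + \<sigma>\<^sub>q\<bar>\<^sup>2 = 4 (1 + swap\<^sub>p\<^sub>q)\<close>, this says that \<open>h\<^sub>1 f = h\<^sub>2 f = h\<^sub>3 f\<close> implies
  \<open>Q f = 4 h\<^sub>1 f\<close>. The reason: \<open>h\<^sub>i\<^sup>2 = Q - 2 h\<^sub>i\<close>, so \<open>\<phi> = (Q - 4 h\<^sub>i) f\<close> does not depend on \<open>i\<close> and
  satisfies \<open>h\<^sub>i \<phi> = - 4 \<phi>\<close> for all three \<open>i\<close>, whereas \<open>h\<^sub>1 + h\<^sub>2 + h\<^sub>3 \<ge> - 10\<close>. For two copies the
  implication fails. As a system of linear equations in the \<open>2\<^sup>5\<close> values of \<open>f\<close>, it is within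
  reach of linear arithmetic.
\<close>

lemma three_copies_real:
  fixes f :: "bool \<Rightarrow> bool \<Rightarrow> bool \<Rightarrow> bool \<Rightarrow> bool \<Rightarrow> real"
  assumes 12: "\<And>p q a b c. f a q p b c + f p a q b c = f b q a p c + f p b a q c"
    and 13: "\<And>p q a b c. f a q p b c + f p a q b c = f c q a b p + f p c a b q"
  shows "f q p a b c + 3 * f p q a b c = 2 * (f a q p b c + f p a q b c)"
proof -
  have all: "\<forall>p q a b c. f q p a b c + 3 * f p q a b c = 2 * (f a q p b c + f p a q b c)"
    using assms unfolding all_bool_eq
    by smt
  then show ?thesis by blast
qed

text \<open>The relations have real coefficients, so real and imaginary parts satisfy them
  separately.\<close>

lemma three_copies:
  fixes f :: "bool \<Rightarrow> bool \<Rightarrow> bool \<Rightarrow> bool \<Rightarrow> bool \<Rightarrow> complex"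
  assumes 12: "\<And>p q a b c. f a q p b c + f p a q b c = f b q a p c + f p b a q c"
    and 13: "\<And>p q a b c. f a q p b c + f p a q b c = f c q a b p + f p c a b q"
  shows "f q p a b c + 3 * f p q a b c = 2 * (f a q p b c + f p a q b c)"
proof (rule complex_eqI)
  have "Re (f q p a b c) + 3 * Re (f p q a b c) = 2 * (Re (f a q p b c) + Re (f p a q b c))"
    by (rule three_copies_real[of "\<lambda>p q a b c. Re (f p q a b c)"])
       (rule arg_cong[OF 12, of Re, unfolded plus_complex.sel]
        arg_cong[OF 13, of Re, unfolded plus_complex.sel])+
  then show "Re (f q p a b c + 3 * f p q a b c) = Re (2 * (f a q p b c + f p a q b c))" by simp
  have "Im (f q p a b c) + 3 * Im (f p q a b c) = 2 * (Im (f a q p b c) + Im (f p a q b c))"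
    by (rule three_copies_real[of "\<lambda>p q a b c. Im (f p q a b c)"])
       (rule arg_cong[OF 12, of Im, unfolded plus_complex.sel]
        arg_cong[OF 13, of Im, unfolded plus_complex.sel])+
  then show "Im (f q p a b c + 3 * f p q a b c) = Im (2 * (f a q p b c + f p a q b c))" by simp
qed

text \<open>Freezing \<open>C\<close> outside the five sites leaves a function of five bits. On the
  ring \<open>q\<close> will precede and \<open>p\<close> follow the site replaced by the copies,
  hence the argument order in \<open>swp\<close>.\<close>

lemma three_sites:
  fixes F :: "(nat \<Rightarrow> bool) \<Rightarrow> complex"
  assumes dist: "distinct [p, q, b0, b1, b2]"
    and 01: "\<And>C. F (swp b0 p C) + F (swp q b0 C) = F (swp b1 p C) + F (swp q b1 C)"
    and 02: "\<And>C. F (swp b0 p C) + F (swp q b0 C) = F (swp b2 p C) + F (swp q b2 C)"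
  shows "F (swp p q C) + 3 * F C = 2 * (F (swp b0 p C) + F (swp q b0 C))"
proof -
  define f where "f x y u v w = F (C(p := x, q := y, b0 := u, b1 := v, b2 := w))" for x y u v w
  have sw: "swp b0 p (C(p := x, q := y, b0 := u, b1 := v, b2 := w)) = C(p := u, q := y, b0 := x, b1 := v, b2 := w)"
    "swp q b0 (C(p := x, q := y, b0 := u, b1 := v, b2 := w)) = C(p := x, q := u, b0 := y, b1 := v, b2 := w)"
    "swp b1 p (C(p := x, q := y, b0 := u, b1 := v, b2 := w)) = C(p := v, q := y, b0 := u, b1 := x, b2 := w)"
    "swp q b1 (C(p := x, q := y, b0 := u, b1 := v, b2 := w)) = C(p := x, q := v, b0 := u, b1 := y, b2 := w)"
    "swp b2 p (C(p := x, q := y, b0 := u, b1 := v, b2 := w)) = C(p := w, q := y, b0 := u, b1 := v, b2 := x)"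
    "swp q b2 (C(p := x, q := y, b0 := u, b1 := v, b2 := w)) = C(p := x, q := w, b0 := u, b1 := v, b2 := y)"
    "swp p q (C(p := x, q := y, b0 := u, b1 := v, b2 := w)) = C(p := y, q := x, b0 := u, b1 := v, b2 := w)"
    for x y u v w
    using dist by (auto simp: swp_def fun_eq_iff)
  have id: "C(p := C p, q := C q, b0 := C b0, b1 := C b1, b2 := C b2) = C" by simp
  have "f y x u v w + 3 * f x y u v w = 2 * (f u y x v w + f x u y v w)" for x y u v w
  proof (rule three_copies)
    fix x y u v w
    show "f u y x v w + f x u y v w = f v y u x w + f x v u y w"
      using 01[of "C(p := x, q := y, b0 := u, b1 := v, b2 := w)"] unfolding sw f_def .
    show "f u y x v w + f x u y v w = f w y u v x + f x w u v y"
      using 02[of "C(p := x, q := y, b0 := u, b1 := v, b2 := w)"] unfolding sw f_def .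
  qed
  from this[of "C q" "C p" "C b0" "C b1" "C b2"]
  have "F (swp p q (C(p := C p, q := C q, b0 := C b0, b1 := C b1, b2 := C b2)))
     + 3 * F (C(p := C p, q := C q, b0 := C b0, b1 := C b1, b2 := C b2))
     = 2 * (F (swp b0 p (C(p := C p, q := C q, b0 := C b0, b1 := C b1, b2 := C b2)))
       + F (swp q b0 (C(p := C p, q := C q, b0 := C b0, b1 := C b1, b2 := C b2))))"
    unfolding sw f_def .
  then show ?thesis unfolding id .
qed

section \<open>Marginals of extensions\<close>

lemma ptrace_mid_index:
  assumes "x < a" "x' < a" "y < c" "y' < c"
  shows "ptrace_mid a b c M $$ (x * c + y, x' * c + y') =
    (\<Sum>z<b. M $$ ((x * b + z) * c + y, (x' * b + z) * c + y'))"
  using index_less[OF assms(1,3)] index_less[OF assms(2,4)] assms(3,4) by (simp add: ptrace_mid_def)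

lemma mid_to_last_index:
  assumes "x < a" "x' < a" "y < b" "y' < b" "z < c" "z' < c"
  shows "mid_to_last a b c M $$ ((x * c + z) * b + y, (x' * c + z') * b + y') =
    M $$ ((x * b + y) * c + z, (x' * b + y') * c + z')"
  using index_less[OF index_less[OF assms(1,5)] assms(3)] index_less[OF index_less[OF assms(2,6)] assms(4)]
    assms by (simp add: mid_to_last_def)

lemma marginal_AB_index:
  assumes "x < a" "x' < a" "y < b" "y' < b"
  shows "marginal_AB a b k i M $$ (x * b + y, x' * b + y') =
    (\<Sum>z<b ^ i. \<Sum>w<b ^ (k - 1 - i).
      M $$ (((x * b ^ i + z) * b + y) * b ^ (k - 1 - i) + w, ((x' * b ^ i + z) * b + y') * b ^ (k - 1 - i) + w))"
proof -
  have "ptrace_mid (a * b ^ Suc i) (b ^ (k - 1 - i)) 1 M $$ ((x * b ^ i + z) * b + y, (x' * b ^ i + z) * b + y')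
    = (\<Sum>w<b ^ (k - 1 - i).
      M $$ (((x * b ^ i + z) * b + y) * b ^ (k - 1 - i) + w, ((x' * b ^ i + z) * b + y') * b ^ (k - 1 - i) + w))"
    if z: "z < b ^ i" for z
  proof -
    have "(x * b ^ i + z) * b + y < a * b ^ Suc i" "(x' * b ^ i + z) * b + y' < a * b ^ Suc i"
      using index_less[OF index_less[OF assms(1) z] assms(3)] index_less[OF index_less[OF assms(2) z] assms(4)]
      by (simp_all add: mult_ac)
    \<comment> \<open>The third tensor factor is one-dimensional, so its only index is
      \<open>0\<close>.\<close>
    from ptrace_mid_index[OF this, of 0 1 0] show ?thesis by simp
  qed
  then show ?thesis
    unfolding marginal_AB_def by (simp add: ptrace_mid_index[OF assms])
qed

text \<open>
  In \<open>A \<otimes> B\<^sub>0 \<otimes> \<dots> \<otimes> B\<^sub>k\<^sub>-\<^sub>1\<close> with \<open>B\<close> the site \<open>l\<close>, the qubits of \<open>A\<close> come first and \<open>B\<^sub>j\<close> sits at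
  position \<open>n - 1 + j\<close>. Below, \<open>c\<close> is a configuration on \<open>A B\<^sub>i\<close>, indexed by the original sites,
  while \<open>z\<close> and \<open>w\<close> fill the copies before and after \<open>B\<^sub>i\<close>.
\<close>

definition glue :: "nat \<Rightarrow> nat \<Rightarrow> nat \<Rightarrow> (nat \<Rightarrow> bool) \<Rightarrow> (nat \<Rightarrow> bool) \<Rightarrow> (nat \<Rightarrow> bool) \<Rightarrow> nat \<Rightarrow> bool" where
  "glue n l i z w c s =
     (if s < l then c s else if s < n - 1 then c (Suc s)
      else if s < n - 1 + i then z (s - (n - 1)) else if s = n - 1 + i then c l else w (s - (n + i)))"

text \<open>Where the original site \<open>m\<close> is found when the copy \<open>B_i\<close>
  stands in for \<open>l\<close>. Sites beyond \<open>l\<close> move down by one, since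
  \<open>l\<close> has left the block \<open>A\<close>.\<close>

definition ext_site :: "nat \<Rightarrow> nat \<Rightarrow> nat \<Rightarrow> nat \<Rightarrow> nat" where
  "ext_site n l i m = (if m < l then m else if m = l then n - 1 + i else m - 1)"

lemma glue_ext_site: "l < n \<Longrightarrow> m < n \<Longrightarrow> glue n l i z w c (ext_site n l i m) = c m"
  by (auto simp: glue_def ext_site_def)

lemma glue_fun_upd:
  assumes "l < n" "m < n"
  shows "glue n l i z w (c(m := b)) = (glue n l i z w c)(ext_site n l i m := b)"
proof
  fix s
  consider "s < l" | "l \<le> s" "s < n - 1" | "n - 1 \<le> s" "s < n - 1 + i" | "s = n - 1 + i" | "n - 1 + i < s"
    by linarith
  then show "glue n l i z w (c(m := b)) s = ((glue n l i z w c)(ext_site n l i m := b)) s"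
    using assms by cases (auto simp: glue_def ext_site_def)
qed

lemma glue_swp:
  assumes "l < n" "m < n" "m' < n"
  shows "glue n l i z w (swp m m' c) = swp (ext_site n l i m) (ext_site n l i m') (glue n l i z w c)"
  unfolding swp_def by (simp add: glue_fun_upd glue_ext_site assms)

text \<open>Lets a statement about glued configurations reach an arbitrary \<open>C\<close>;
  agreement below \<open>n - 1 + k\<close> is all that the encoding sees.\<close>

lemma glue_surj:
  assumes "l < n" "i < k"
  shows "\<exists>c. \<exists>z\<in>configs i. \<exists>w\<in>configs (k - 1 - i). \<forall>s<n - 1 + k. glue n l i z w c s = C s"
proof (intro exI bexI allI impI)
  let ?c = "\<lambda>m. C (ext_site n l i m)"
  let ?z = "\<lambda>s. s < i \<and> C (n - 1 + s)"
  let ?w = "\<lambda>s. s < k - 1 - i \<and> C (n + i + s)"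
  show "?z \<in> configs i" "?w \<in> configs (k - 1 - i)" by (auto simp: configs_def)
  fix s assume s: "s < n - 1 + k"
  consider "s < l" | "l \<le> s" "s < n - 1" | "n - 1 \<le> s" "s < n - 1 + i" | "s = n - 1 + i" | "n - 1 + i < s"
    by linarith
  then show "glue n l i ?z ?w ?c s = C s"
    using assms s by cases (auto simp: glue_def ext_site_def)
qed

text \<open>The nesting matches the indices in \<open>marginal_AB_index\<close>, so that summing
  over \<open>z\<close> and \<open>w\<close> traces out the other copies.\<close>

lemma enc_glue:
  assumes "l < n" "i < k"
  shows "enc (n - 1 + k) (glue n l i z w c) =
    (((enc l c * 2 ^ (n - 1 - l) + enc (n - 1 - l) (\<lambda>s. c (Suc l + s))) * 2 ^ i + enc i z) * 2
      + of_bool (c l)) * 2 ^ (k - 1 - i) + enc (k - 1 - i) w"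
proof -
  let ?g = "glue n l i z w c"
  have A: "enc (n - 1) ?g = enc l c * 2 ^ (n - 1 - l) + enc (n - 1 - l) (\<lambda>s. c (Suc l + s))"
  proof -
    have "enc (n - 1) ?g = enc (l + (n - 1 - l)) ?g" using assms by simp
    also have "\<dots> = enc l ?g * 2 ^ (n - 1 - l) + enc (n - 1 - l) (\<lambda>s. ?g (l + s))" by (rule enc_add)
    also have "enc l ?g = enc l c" by (rule enc_cong) (simp add: glue_def)
    also have "enc (n - 1 - l) (\<lambda>s. ?g (l + s)) = enc (n - 1 - l) (\<lambda>s. c (Suc l + s))"
      by (rule enc_cong) (use assms in \<open>auto simp: glue_def\<close>)
    finally show ?thesis .
  qed
  have B: "enc (n - 1 + i) ?g = enc (n - 1) ?g * 2 ^ i + enc i z"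
    unfolding enc_add using assms by (auto simp: glue_def intro!: enc_cong)
  have r: "n - 1 + k - 1 - (n - 1 + i) = k - 1 - i" using assms by simp
  have "enc (n - 1 + k) ?g = (enc (n - 1 + i) ?g * 2 + of_bool (?g (n - 1 + i))) * 2 ^ (k - 1 - i)
      + enc (k - 1 - i) (\<lambda>s. ?g (Suc (n - 1 + i) + s))"
    using enc_site[of "n - 1 + i" "n - 1 + k" ?g] assms unfolding r by simp
  also have "?g (n - 1 + i) = c l" using assms by (auto simp: glue_def)
  also have "enc (k - 1 - i) (\<lambda>s. ?g (Suc (n - 1 + i) + s)) = enc (k - 1 - i) w"
    using assms by (intro enc_cong) (auto simp: glue_def)
  finally show ?thesis unfolding B A .
qed

lemma extension_marginal:
  assumes l: "l < n" and i: "i < k"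
    and marg: "marginal_AB (2 ^ l * 2 ^ (n - 1 - l)) 2 k i \<sigma> = mid_to_last (2 ^ l) 2 (2 ^ (n - 1 - l)) \<rho>"
  shows "\<rho> $$ (enc n c, enc n d) = (\<Sum>z\<in>configs i. \<Sum>w\<in>configs (k - 1 - i).
    \<sigma> $$ (enc (n - 1 + k) (glue n l i z w c), enc (n - 1 + k) (glue n l i z w d)))"
proof -
  define r where "r = n - 1 - l"
  define y where "y c = enc r (\<lambda>s. c (Suc l + s))" for c
  define x where "x c = enc l c * 2 ^ r + y c" for c
  have y: "y c < 2 ^ r" for c unfolding y_def by (rule enc_less)
  have x: "x c < 2 ^ l * 2 ^ r" for c unfolding x_def by (rule index_less[OF enc_less y])
  have b: "of_bool (c l) < (2::nat)" for c :: "nat \<Rightarrow> bool" by simp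
  have "\<rho> $$ (enc n c, enc n d) =
     \<rho> $$ ((enc l c * 2 + of_bool (c l)) * 2 ^ r + y c, (enc l d * 2 + of_bool (d l)) * 2 ^ r + y d)"
    unfolding enc_site[OF l] r_def y_def ..
  also have "\<dots> = mid_to_last (2 ^ l) 2 (2 ^ r) \<rho> $$ (x c * 2 + of_bool (c l), x d * 2 + of_bool (d l))"
    unfolding x_def by (rule mid_to_last_index[symmetric, OF enc_less enc_less b b y y])
  also have "\<dots> = (\<Sum>z<2 ^ i. \<Sum>w<2 ^ (k - 1 - i).
      \<sigma> $$ (((x c * 2 ^ i + z) * 2 + of_bool (c l)) * 2 ^ (k - 1 - i) + w,
            ((x d * 2 ^ i + z) * 2 + of_bool (d l)) * 2 ^ (k - 1 - i) + w))"
    unfolding marg[folded r_def, symmetric] by (rule marginal_AB_index[OF x x b b])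
  also have "\<dots> = (\<Sum>z\<in>configs i. \<Sum>w\<in>configs (k - 1 - i).
    \<sigma> $$ (enc (n - 1 + k) (glue n l i z w c), enc (n - 1 + k) (glue n l i z w d)))"
    unfolding enc_glue[OF l i] sum_configs[symmetric] x_def y_def r_def ..
  finally show ?thesis .
qed

text \<open>Let \<open>X\<close> be the weighted sum of swaps. For fixed \<open>c\<close>, the forms
  of \<open>\<sigma>\<close> on the vectors glued with \<open>z\<close> and \<open>w\<close> add up
  to the diagonal entry at \<open>c\<close> of \<open>X \<rho> X\<^sup>T\<close>, which is zero.
  Being nonnegative, each form vanishes and so yields a kernel vector of
  \<open>\<sigma>\<close>.\<close>

lemma extension_kernel:
  fixes m :: "'t \<Rightarrow> real" and a b :: "'t \<Rightarrow> nat"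
  assumes l: "l < n" and i: "i < k"
    and marg: "marginal_AB (2 ^ l * 2 ^ (n - 1 - l)) 2 k i \<sigma> = mid_to_last (2 ^ l) 2 (2 ^ (n - 1 - l)) \<rho>"
    and \<sigma>: "density_operator (2 ^ (n - 1 + k)) \<sigma>"
    and I: "finite I" and ab: "\<And>t. t \<in> I \<Longrightarrow> a t < n" "\<And>t. t \<in> I \<Longrightarrow> b t < n"
    and ker: "\<And>c s. s < 2 ^ n \<Longrightarrow> (\<Sum>t\<in>I. of_real (m t) * \<rho> $$ (enc n (swp (a t) (b t) c), s)) = 0"
    and s: "s < 2 ^ (n - 1 + k)"
  shows "(\<Sum>t\<in>I. of_real (m t) * \<sigma> $$ (enc (n - 1 + k) (swp (ext_site n l i (a t)) (ext_site n l i (b t)) C), s)) = 0"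
proof -
  let ?K = "n - 1 + k"
  \<comment> \<open>The pair \<open>z0\<close>, \<open>w0\<close> marks the summand belonging to
    \<open>C\<close>, singled out at the end.\<close>
  obtain c z0 w0 where zw: "z0 \<in> configs i" "w0 \<in> configs (k - 1 - i)"
    and C: "\<forall>s<?K. glue n l i z0 w0 c s = C s"
    using glue_surj[OF l i] by blast
  define Q where "Q z w = (\<Sum>t\<in>I. \<Sum>u\<in>I. of_real (m t) * of_real (m u) *
    \<sigma> $$ (enc ?K (glue n l i z w (swp (a t) (b t) c)), enc ?K (glue n l i z w (swp (a u) (b u) c))))" for z w
  have pos: "0 \<le> Q z w" for z w
    unfolding Q_def by (rule density_operator_point_masses_nonneg[OF \<sigma> I enc_less])
  have "(\<Sum>z\<in>configs i. \<Sum>w\<in>configs (k - 1 - i). Q z w) =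
    (\<Sum>z\<in>configs i. \<Sum>t\<in>I. \<Sum>u\<in>I. \<Sum>w\<in>configs (k - 1 - i). of_real (m t) * of_real (m u) *
    \<sigma> $$ (enc ?K (glue n l i z w (swp (a t) (b t) c)), enc ?K (glue n l i z w (swp (a u) (b u) c))))"
    unfolding Q_def by (rule sum.cong[OF refl], subst sum.swap, rule sum.cong[OF refl], rule sum.swap)
  also have "\<dots> = (\<Sum>t\<in>I. \<Sum>u\<in>I. \<Sum>z\<in>configs i. \<Sum>w\<in>configs (k - 1 - i). of_real (m t) * of_real (m u) *
    \<sigma> $$ (enc ?K (glue n l i z w (swp (a t) (b t) c)), enc ?K (glue n l i z w (swp (a u) (b u) c))))"
    by (subst sum.swap, rule sum.cong[OF refl], rule sum.swap)
  also have "\<dots> = (\<Sum>t\<in>I. \<Sum>u\<in>I. of_real (m t) * of_real (m u) *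
      \<rho> $$ (enc n (swp (a t) (b t) c), enc n (swp (a u) (b u) c)))"
    unfolding extension_marginal[OF l i marg] sum_distrib_left ..
  also have "\<dots> = (\<Sum>u\<in>I. of_real (m u) * (\<Sum>t\<in>I. of_real (m t) *
      \<rho> $$ (enc n (swp (a t) (b t) c), enc n (swp (a u) (b u) c))))"
    unfolding sum_distrib_left by (subst sum.swap) (simp add: mult_ac)
  also have "\<dots> = 0" by (simp add: ker enc_less)
  finally have "Re (\<Sum>z\<in>configs i. \<Sum>w\<in>configs (k - 1 - i). Q z w) = 0" by simp
  then have "(\<Sum>z\<in>configs i. \<Sum>w\<in>configs (k - 1 - i). Re (Q z w)) = 0"
    by (simp only: Re_sum)
  moreover have rpos: "0 \<le> Re (Q z w)" for z w using pos[of z w] by (simp add: less_eq_complex_def)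
  ultimately have "Re (Q z0 w0) = 0"
    using zw finite_configs by (simp add: sum_nonneg_eq_0_iff sum_nonneg)
  then have "Q z0 w0 = 0" using pos[of z0 w0] by (simp add: less_eq_complex_def complex_eq_iff)
  from density_operator_point_masses_kernel[OF \<sigma> I enc_less this[unfolded Q_def] s]
  have "(\<Sum>t\<in>I. of_real (m t) * \<sigma> $$ (enc ?K (glue n l i z0 w0 (swp (a t) (b t) c)), s)) = 0" .
  moreover have "enc ?K (glue n l i z0 w0 (swp (a t) (b t) c)) =
    enc ?K (swp (ext_site n l i (a t)) (ext_site n l i (b t)) C)" if t: "t \<in> I" for t
  proof -
    have "ext_site n l i (a t) < ?K" "ext_site n l i (b t) < ?K"
      using ab[OF t] l i by (auto simp: ext_site_def)
    then show ?thesis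
      unfolding glue_swp[OF l ab(1)[OF t] ab(2)[OF t]] using C by (intro enc_cong) (auto simp: swp_def)
  qed
  ultimately show ?thesis by simp
qed

section \<open>Ground states are not extendible\<close>

text \<open>All copies obey the same eigenvalue equation, which differs between them only in the two
  bonds at \<open>l\<close>; this supplies the premises of \<open>three_sites\<close>. The resulting
  relation on \<open>\<sigma>\<close> passes to \<open>\<rho>\<close> through the marginal on the
  first copy.\<close>

lemma extendible_ground_state_local:
  fixes J E :: real
  assumes n: "3 \<le> n" and l: "l < n" and q: "q < n" "Suc q mod n = l" and k: "3 \<le> k" and J: "J > 0"
    and eig: "\<And>c s. s < 2 ^ n \<Longrightarrow> (\<Sum>t<n. complex_of_real (2 * J) * \<rho> $$ (enc n (swp t (Suc t mod n) c), s))
      = complex_of_real (J * n + E) * \<rho> $$ (enc n c, s)"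
    and ext: "bipartite_extendible k (2 ^ l * 2 ^ (n - 1 - l)) 2 (mid_to_last (2 ^ l) 2 (2 ^ (n - 1 - l)) \<rho>)"
  shows "\<rho> $$ (enc n (swp (Suc l mod n) q c), enc n d) + 3 * \<rho> $$ (enc n c, enc n d) =
    2 * (\<rho> $$ (enc n (swp l (Suc l mod n) c), enc n d) + \<rho> $$ (enc n (swp q l c), enc n d))"
proof -
  let ?K = "n - 1 + k" and ?m = "Suc l mod n"
  have "l + (n - 1 - l) + k = ?K" using l by simp
  then have "(2::nat) ^ l * 2 ^ (n - 1 - l) * 2 ^ k = 2 ^ ?K" by (simp only: power_add[symmetric])
  then obtain \<sigma> where \<sigma>: "density_operator (2 ^ ?K) \<sigma>"
    and marg: "\<And>i. i < k \<Longrightarrow> marginal_AB (2 ^ l * 2 ^ (n - 1 - l)) 2 k i \<sigma> = mid_to_last (2 ^ l) 2 (2 ^ (n - 1 - l)) \<rho>"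
    using ext unfolding bipartite_extendible_def by auto
  have m: "?m < n" "?m \<noteq> l" "?m \<noteq> q" "q \<noteq> l"
    using n l q by (auto simp: mod_Suc split: if_splits)
  \<comment> \<open>Only the bonds starting at \<open>l\<close> and at \<open>q\<close> meet
    \<open>l\<close>.\<close>
  have succ: "Suc t mod n \<noteq> l" if "t < n" "t \<noteq> q" for t
    using that q n l by (auto simp: mod_Suc split: if_splits)
  define P where "P = ext_site n l 0 ?m"
  define R where "R = ext_site n l 0 q"
  \<comment> \<open>Sites other than \<open>l\<close> keep the same position whichever copy is
    chosen.\<close>
  have P: "ext_site n l i ?m = P" and R: "ext_site n l i q = R" for i
    using m by (simp_all add: P_def R_def ext_site_def)
  have PR: "P < n - 1" "R < n - 1" "P \<noteq> R"
  proof -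
    have "ext_site n l 0 t < n - 1" if "t < n" "t \<noteq> l" for t
      using that l by (auto simp: ext_site_def)
    then show "P < n - 1" "R < n - 1" using m q by (simp_all add: P_def R_def)
    have "ext_site n l 0 t \<noteq> ext_site n l 0 u" if "t \<noteq> u" "t \<noteq> l" "u \<noteq> l" for t u
      using that by (auto simp: ext_site_def)
    then show "P \<noteq> R" using m by (simp add: P_def R_def)
  qed
  have loc: "\<sigma> $$ (enc ?K (swp P R C), enc ?K D) + 3 * \<sigma> $$ (enc ?K C, enc ?K D) =
    2 * (\<sigma> $$ (enc ?K (swp (n - 1) P C), enc ?K D) + \<sigma> $$ (enc ?K (swp R (n - 1) C), enc ?K D))" for C D
  proof -
    define F where "F C = \<sigma> $$ (enc ?K C, enc ?K D)" for C
    \<comment> \<open>These bonds avoid \<open>l\<close>, so copy \<open>0\<close> can stand here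
      for every copy.\<close>
    define G where "G C = (\<Sum>t\<in>{..<n} - {l} - {q}. F (swp (ext_site n l 0 t) (ext_site n l 0 (Suc t mod n)) C))" for C
    have Feq: "of_real (2 * J) * (F (swp (n - 1 + i) P C) + F (swp R (n - 1 + i) C)) =
       of_real (J * n + E) * F C - of_real (2 * J) * G C" if i: "i < k" for i C
    proof -
      \<comment> \<open>The scalar \<open>- (J * n + E)\<close> becomes an extra index
        \<open>t = n\<close>, attached to the trivial swap of site \<open>0\<close> with
        itself.\<close>
      define a where "a t = (if t = n then 0 else t)" for t
      define b where "b t = (if t = n then 0 else Suc t mod n)" for t
      define w where "w t = (if t = n then - (J * n + E) else 2 * J)" for t
      have swp_same: "swp x x c = c" for x c by (simp add: swp_def)
      have "(\<Sum>t\<in>{..n}. of_real (w t) *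
          \<sigma> $$ (enc ?K (swp (ext_site n l i (a t)) (ext_site n l i (b t)) C), enc ?K D)) = 0"
      proof (rule extension_kernel[OF l i marg[OF i] \<sigma>])
        fix c s assume s: "s < (2::nat) ^ n"
        have "(\<Sum>t\<in>{..n}. of_real (w t) * \<rho> $$ (enc n (swp (a t) (b t) c), s)) =
          (\<Sum>t<n. of_real (w t) * \<rho> $$ (enc n (swp (a t) (b t) c), s)) - of_real (J * n + E) * \<rho> $$ (enc n c, s)"
          by (simp add: lessThan_Suc_atMost[symmetric] w_def a_def b_def swp_same algebra_simps)
        also have "(\<Sum>t<n. of_real (w t) * \<rho> $$ (enc n (swp (a t) (b t) c), s)) =
          (\<Sum>t<n. of_real (2 * J) * \<rho> $$ (enc n (swp t (Suc t mod n) c), s))"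
          by (rule sum.cong[OF refl]) (simp add: w_def a_def b_def)
        finally show "(\<Sum>t\<in>{..n}. of_real (w t) * \<rho> $$ (enc n (swp (a t) (b t) c), s)) = 0"
          using eig[OF s] by simp
      qed (use n in \<open>auto simp: a_def b_def enc_less\<close>)
      also have "(\<Sum>t\<in>{..n}. of_real (w t) *
          \<sigma> $$ (enc ?K (swp (ext_site n l i (a t)) (ext_site n l i (b t)) C), enc ?K D)) =
        (\<Sum>t<n. of_real (w t) * F (swp (ext_site n l i (a t)) (ext_site n l i (b t)) C)) - of_real (J * n + E) * F C"
        by (simp add: lessThan_Suc_atMost[symmetric] w_def a_def b_def swp_same F_def algebra_simps)
      also have "(\<Sum>t<n. of_real (w t) * F (swp (ext_site n l i (a t)) (ext_site n l i (b t)) C)) =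
        of_real (2 * J) * (\<Sum>t<n. F (swp (ext_site n l i t) (ext_site n l i (Suc t mod n)) C))"
        unfolding sum_distrib_left by (rule sum.cong[OF refl]) (simp add: w_def a_def b_def)
      also have "(\<Sum>t<n. F (swp (ext_site n l i t) (ext_site n l i (Suc t mod n)) C)) =
        F (swp (ext_site n l i l) (ext_site n l i ?m) C) + (F (swp (ext_site n l i q) (ext_site n l i (Suc q mod n)) C)
         + (\<Sum>t\<in>{..<n} - {l} - {q}. F (swp (ext_site n l i t) (ext_site n l i (Suc t mod n)) C)))"
        using l q m by (simp add: sum.remove[of "{..<n}" l] sum.remove[of "{..<n} - {l}" q])
      also have "(\<Sum>t\<in>{..<n} - {l} - {q}. F (swp (ext_site n l i t) (ext_site n l i (Suc t mod n)) C)) = G C"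
        unfolding G_def using succ by (intro sum.cong) (auto simp: ext_site_def)
      also have "ext_site n l i (Suc q mod n) = n - 1 + i" using q by (simp add: ext_site_def)
      also have "ext_site n l i l = n - 1 + i" by (simp add: ext_site_def)
      finally show ?thesis unfolding P R by (simp add: algebra_simps)
    qed
    \<comment> \<open>The right-hand side of \<open>Feq\<close> does not depend on \<open>i\<close>,
      and \<open>2 * J\<close> can be cancelled.\<close>
    have shift: "F (swp (n - 1) P C) + F (swp R (n - 1) C) = F (swp (n - 1 + i) P C) + F (swp R (n - 1 + i) C)"
      if "i < k" for i C
    proof -
      have k0: "0 < k" using k by simp
      have "of_real (2 * J) * (F (swp (n - 1) P C) + F (swp R (n - 1) C)) =
        of_real (2 * J) * (F (swp (n - 1 + i) P C) + F (swp R (n - 1 + i) C))"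
        using Feq[OF k0, of C] unfolding Feq[OF that] by (simp only: add_0_right)
      moreover have "complex_of_real (2 * J) \<noteq> 0" using J by simp
      ultimately show ?thesis using mult_left_cancel by blast
    qed
    have "F (swp P R C) + 3 * F C = 2 * (F (swp (n - 1) P C) + F (swp R (n - 1) C))"
    proof (rule three_sites)
      \<comment> \<open>The copies \<open>B_0\<close>, \<open>B_1\<close>, \<open>B_2\<close> occupy
        \<open>n - 1\<close>, \<open>n\<close>, \<open>n + 1\<close>, while \<open>P\<close> and
        \<open>R\<close> lie in the block \<open>A\<close> below them.\<close>
      show "distinct [P, R, n - 1, n - 1 + 1, n - 1 + 2]" using PR by auto
    qed (rule shift; use k in simp)+
    then show ?thesis by (simp only: F_def)
  qed
  have k0: "0 < k" using k by simp
  have pos0: "ext_site n l 0 l = n - 1" by (simp add: ext_site_def)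
  show ?thesis
    unfolding extension_marginal[OF l k0 marg[OF k0]] glue_swp[OF l m(1) q(1)] glue_swp[OF l l m(1)] glue_swp[OF l q(1) l]
      P R pos0 sum_distrib_left sum.distrib[symmetric]
    by (rule sum.cong[OF refl], rule sum.cong[OF refl], rule loc)
qed

section \<open>Swap expectations and the energy bound\<close>

lemma sum_density_configs:
  assumes "density_operator (2 ^ n) \<rho>"
  shows "(\<Sum>c\<in>configs n. \<rho> $$ (enc n c, enc n c)) = 1"
proof -
  have "dim_row \<rho> = 2 ^ n" "mat_trace \<rho> = 1" using assms by (auto simp: density_operator_def)
  then show ?thesis using sum_configs[of "\<lambda>i. \<rho> $$ (i, i)" n] by (simp add: mat_trace_def)
qed

lemma sum_configs_swp:
  assumes "x < n" "y < n"
  shows "(\<Sum>c\<in>configs n. f (swp x y c)) = (\<Sum>c\<in>configs n. f c)"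
proof (rule sum.reindex_bij_betw)
  show "bij_betw (swp x y) (configs n) (configs n)"
    using swp_configs[OF assms] by (intro bij_betw_byWitness[of _ "swp x y"]) (simp_all add: image_subset_iff)
qed

text \<open>The form of \<open>\<rho>\<close> on \<open>e_c + e_(swp x y c)\<close> is nonnegative;
  summing over \<open>c\<close> gives \<open>2 + 2 Re (Tr (swap \<rho>)) \<ge> 0\<close>.\<close>

lemma swap_expectation_ge:
  assumes \<rho>: "density_operator (2 ^ n) \<rho>" and xy: "x < n" "y < n"
  shows "- 1 \<le> Re (\<Sum>c\<in>configs n. \<rho> $$ (enc n (swp x y c), enc n c))"
proof -
  let ?s = "swp x y"
  have "0 \<le> \<rho> $$ (enc n c, enc n c) + \<rho> $$ (enc n c, enc n (?s c))
      + (\<rho> $$ (enc n (?s c), enc n c) + \<rho> $$ (enc n (?s c), enc n (?s c)))" for c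
    using density_operator_point_masses_nonneg[OF \<rho>, of "{0, 1::nat}" "\<lambda>t. enc n (if t = 0 then c else ?s c)" "\<lambda>_. 1"]
    by (simp add: enc_less add_ac)
  then have "0 \<le> (\<Sum>c\<in>configs n. Re (\<rho> $$ (enc n c, enc n c) + \<rho> $$ (enc n c, enc n (?s c))
      + (\<rho> $$ (enc n (?s c), enc n c) + \<rho> $$ (enc n (?s c), enc n (?s c)))))"
    by (intro sum_nonneg) (simp add: less_eq_complex_def)
  also have "\<dots> = Re ((\<Sum>c\<in>configs n. \<rho> $$ (enc n c, enc n c)) + (\<Sum>c\<in>configs n. \<rho> $$ (enc n c, enc n (?s c)))
      + ((\<Sum>c\<in>configs n. \<rho> $$ (enc n (?s c), enc n c)) + (\<Sum>c\<in>configs n. \<rho> $$ (enc n (?s c), enc n (?s c)))))"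
    by (simp add: sum.distrib)
  also have "(\<Sum>c\<in>configs n. \<rho> $$ (enc n c, enc n (?s c))) = (\<Sum>c\<in>configs n. \<rho> $$ (enc n (?s c), enc n c))"
    using sum_configs_swp[OF xy, of "\<lambda>c. \<rho> $$ (enc n (?s c), enc n c)"] by simp
  also have "(\<Sum>c\<in>configs n. \<rho> $$ (enc n (?s c), enc n (?s c))) = (\<Sum>c\<in>configs n. \<rho> $$ (enc n c, enc n c))"
    by (rule sum_configs_swp[OF xy])
  finally show ?thesis unfolding sum_density_configs[OF \<rho>] by simp
qed

text \<open>With \<open>g l\<close> the swap expectation on bond \<open>l\<close>, the bond energy
  is \<open>J * (2 * g l - 1)\<close>, so the bound \<open>site\<close> says that the two bonds at
  \<open>l\<close> have nonnegative total energy. Summation gives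
  \<open>2 * \<Sum> g \<ge> n\<close> in real parts, and \<open>2 * J * \<Sum> g = J * n + E\<close>
  then forces \<open>E \<ge> 0\<close>.\<close>

lemma ground_state_H_XXX_not_extendible:
  assumes n: "3 \<le> n" and J: "J > 0" and k: "2 < k" and \<rho>: "ground_state (H_XXX J n) \<rho>"
  shows "multipartite_unextendible k (replicate n 2) \<rho>"
proof -
  have "dim_row (H_XXX J n) = 2 ^ n" using H_XXX_carrier by blast
  then have dens: "density_operator (2 ^ n) \<rho>" using \<rho> by (simp add: ground_state_def)
  have "\<not> multipartite_extendible k (replicate n 2) \<rho>"
  proof
    assume "multipartite_extendible k (replicate n 2) \<rho>"
    then have ext: "bipartite_extendible k (2 ^ l * 2 ^ (n - 1 - l)) 2 (mid_to_last (2 ^ l) 2 (2 ^ (n - 1 - l)) \<rho>)"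
      if "l < n" for l
      using that by (auto simp: multipartite_extendible_def Let_def)
    have "2 \<le> n" using n by simp
    then obtain E where E: "E < 0" and eig: "\<And>c s. s < 2 ^ n \<Longrightarrow>
      (\<Sum>l<n. complex_of_real (2 * J) * \<rho> $$ (enc n (swp l (Suc l mod n) c), s))
        = complex_of_real (J * n + E) * \<rho> $$ (enc n c, s)"
      using ground_state_H_XXX[OF _ J \<rho>] by blast
    define g where "g l = (\<Sum>c\<in>configs n. \<rho> $$ (enc n (swp l (Suc l mod n) c), enc n c))" for l
    \<comment> \<open>Subtraction on naturals stops at \<open>0\<close>, so the step back from site
      \<open>0\<close> to \<open>n - 1\<close> is written out.\<close>
    define prev where "prev l = (if l = 0 then n - 1 else l - 1)" for l
    have prev: "prev l < n" "Suc (prev l) mod n = l" if "l < n" for l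
      using that n by (auto simp: prev_def)
    \<comment> \<open>The swap of the two neighbours has expectation at least \<open>- 1\<close>, so
      \<open>2 * (g l + g (prev l))\<close> has real part at least \<open>3 - 1\<close>.\<close>
    have site: "1 \<le> Re (g l) + Re (g (prev l))" if l: "l < n" for l
    proof -
      let ?r = "\<Sum>c\<in>configs n. \<rho> $$ (enc n (swp (Suc l mod n) (prev l) c), enc n c)"
      have "?r + 3 * (\<Sum>c\<in>configs n. \<rho> $$ (enc n c, enc n c)) = 2 * (g l + g (prev l))"
        unfolding g_def prev(2)[OF l] sum_distrib_left sum.distrib[symmetric]
        by (rule sum.cong[OF refl])
           (rule extendible_ground_state_local[OF n l prev[OF l] _ J eig ext[OF l]], use k in auto)
      then have "Re (?r + 3) = Re (2 * (g l + g (prev l)))"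
        unfolding sum_density_configs[OF dens] by simp
      moreover have "- 1 \<le> Re ?r" using l prev[OF l] by (intro swap_expectation_ge[OF dens]) auto
      ultimately show ?thesis by simp
    qed
    \<comment> \<open>\<open>prev\<close> permutes the ring, so the sum of the site bounds counts
      every bond twice.\<close>
    have "(\<Sum>l<n. Re (g (prev l))) = (\<Sum>l<n. Re (g l))"
      by (rule sum.reindex_bij_witness[of _ "\<lambda>l. Suc l mod n" prev])
         (use n prev in \<open>auto simp: prev_def mod_Suc\<close>)
    moreover have "(\<Sum>l<n. (1::real)) \<le> (\<Sum>l<n. Re (g l) + Re (g (prev l)))"
      by (rule sum_mono) (simp add: site)
    ultimately have lower: "real n \<le> 2 * (\<Sum>l<n. Re (g l))" by (simp add: sum.distrib)
    have "(\<Sum>c\<in>configs n. \<Sum>l<n. complex_of_real (2 * J) * \<rho> $$ (enc n (swp l (Suc l mod n) c), enc n c))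
      = complex_of_real (J * n + E) * (\<Sum>c\<in>configs n. \<rho> $$ (enc n c, enc n c))"
      by (simp only: eig[OF enc_less] sum_distrib_left)
    moreover have "(\<Sum>c\<in>configs n. \<Sum>l<n. complex_of_real (2 * J) * \<rho> $$ (enc n (swp l (Suc l mod n) c), enc n c))
      = complex_of_real (2 * J) * (\<Sum>l<n. g l)"
      unfolding g_def sum_distrib_left by (rule sum.swap)
    ultimately have "complex_of_real (2 * J) * (\<Sum>l<n. g l) = complex_of_real (J * n + E)"
      by (simp add: sum_density_configs[OF dens])
    then have "Re (complex_of_real (2 * J) * (\<Sum>l<n. g l)) = J * n + E" by (simp only: Re_complex_of_real)
    then have "J * (2 * (\<Sum>l<n. Re (g l))) = J * n + E" by (simp add: mult_ac)
    moreover have "J * real n \<le> J * (2 * (\<Sum>l<n. Re (g l)))"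
      using mult_left_mono[OF lower, of J] J by simp
    ultimately show False using E by simp
  qed
  then show ?thesis using dens by (simp add: multipartite_unextendible_def)
qed

theorem theorem1:
  fixes J :: real and k :: nat
  assumes "J > 0" and "k > 2"
  shows "\<forall>\<^sub>F N in sequentially. \<forall>\<rho>.
    ground_state (H_XXX J (2 * N)) \<rho> \<longrightarrow>
    multipartite_unextendible k (replicate (2 * N) 2) \<rho>"
  using eventually_ge_at_top[of 2]
proof eventually_elim
  case (elim N)
  \<comment> \<open>\<open>N \<ge> 2\<close> gives at least four sites; from three sites on, the two
    neighbours of a site are distinct.\<close>
  then show ?case using ground_state_H_XXX_not_extendible[of "2 * N" J k] assms by simp
qed

end
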